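(* Let $P_{XY}$ be a probability measure defined on $\mathcal{X}\times\mathcal{Y}$, with $\mathcal{X}$ finite or countably infinite, such that $P_{X|Y}(x|y)>0$ for all $(x,y)\in\mathcal{X}\times\mathcal{Y}$. Let $L\ge1$ be an integer with $L\le|\mathcal{X}|$, let $\mathcal{L}\colon\mathcal{Y}\to\binom{\mathcal{X}}{L}$, and let $P_{\mathcal{L}}=\mathbb{P}[X\notin\mathcal{L}(Y)]$. Then, for all $\alpha\in(1,\infty)$, $$P_{\mathcal{L}}\ge1-\exp\left(\frac{1-\alpha}{\alpha}\Bigl[H_\alpha(X|Y)-\log L\Bigr]\right).$$
   Context: Logarithms have an arbitrary fixed base larger than 1 and $\exp$ is the inverse of $\log$. $(X,Y)\sim P_{XY}$, with $\mathcal{Y}$ an arbitrary observation space. $\binom{\mathcal{X}}{L}$ denotes the set of all subsets of $\mathcal{X}$ of cardinality $L$. The Arimoto-R\'enyi conditional entropy of order $\alpha\in(1,\infty)$ is $$H_\alpha(X|Y)=\frac{\alpha}{1-\alpha}\log\mathbb{E}\left[\Bigl(\sum_{x\in\mathcal{X}}P_{X|Y}^\alpha(x|Y)\Bigr)^{1/\alpha}\right],$$ the expectation being over $Y\sim P_Y$. *)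

theory Defs
  imports "HOL-Probability.Probability" "HOL-Library.Ramsey"
begin

text \<open>
  The joint law \<open>P\<close> lives on \<open>count_space \<X> \<Otimes>\<^sub>M N\<close>, where \<open>N\<close> only contributes the measurable
  space of observations; its measure is irrelevant.
\<close>

definition observation_law :: "'y measure \<Rightarrow> ('x \<times> 'y) measure \<Rightarrow> 'y measure" where
  "observation_law N P = distr P N snd"

text \<open>
  \<open>cond_pmf_version \<X> N P K\<close>: \<open>K x y\<close> is a version of the regular conditional probability mass
  function of \<open>X\<close> at \<open>x\<close> given \<open>Y = y\<close>.  Versions are determined by \<open>P\<close> only up to null sets of
  observations, which is why \<open>K\<close> is a parameter rather than a function of \<open>P\<close>.
\<close>

definition cond_pmf_version ::
    "'x set \<Rightarrow> 'y measure \<Rightarrow> ('x \<times> 'y) measure \<Rightarrow> ('x \<Rightarrow> 'y \<Rightarrow> real) \<Rightarrow> bool" where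
  "cond_pmf_version \<X> N P K \<longleftrightarrow>
     (\<forall>x\<in>\<X>. K x \<in> borel_measurable N) \<and>
     (\<forall>y\<in>space N. (\<forall>x\<in>\<X>. 0 \<le> K x y) \<and> ((\<lambda>x. K x y) has_sum 1) \<X>) \<and>
     (\<forall>x\<in>\<X>. \<forall>A\<in>sets N.
        measure P ({x} \<times> A) = (LINT y:A|observation_law N P. K x y))"

text \<open>
  The Arimoto--Renyi conditional entropy of order \<open>\<alpha>\<close>, with logarithms to base \<open>b\<close>.  For \<open>\<alpha> > 1\<close>
  and \<open>K\<close> a conditional probability mass function, the inner series and the expectation both lie
  in \<open>(0, 1]\<close>, so no default value of a sum, an integral or a logarithm is ever used.
\<close>

definition arimoto_renyi_cond_entropy ::
    "real \<Rightarrow> real \<Rightarrow> 'x set \<Rightarrow> 'y measure \<Rightarrow> ('x \<times> 'y) measure \<Rightarrow> ('x \<Rightarrow> 'y \<Rightarrow> real) \<Rightarrow> real" where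
  "arimoto_renyi_cond_entropy b \<alpha> \<X> N P K =
     \<alpha> / (1 - \<alpha>) *
       log b (\<integral>y. (\<Sum>\<^sub>\<infinity>x\<in>\<X>. K x y powr \<alpha>) powr (1 / \<alpha>) \<partial>observation_law N P)"

end

theory Submission imports Defs begin

text \<open>
  Given \<open>Y = y\<close>, the power mean inequality bounds the probability of any \<open>L\<close>-element list by
  \<open>L powr (1 - 1 / \<alpha>)\<close> times the \<open>\<alpha>\<close>-norm of the conditional probability mass function.
  Averaging over \<open>Y\<close> bounds the probability of correct list decoding by
  \<open>L powr (1 - 1 / \<alpha>)\<close> times the expected norm, which is the exponential in the claim.
\<close>

lemma sum_le_card_powr_mult_powr_sum:
  fixes a :: "'a \<Rightarrow> real"
  assumes "finite A" and pos: "\<And>x. x \<in> A \<Longrightarrow> 0 < a x" and "1 \<le> \<alpha>"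
  shows "(\<Sum>x\<in>A. a x) \<le> real (card A) powr (1 - 1 / \<alpha>) * (\<Sum>x\<in>A. a x powr \<alpha>) powr (1 / \<alpha>)"
proof (cases "A = {}")
  case False
  define n where "n = real (card A)"
  have n: "0 < n" using \<open>finite A\<close> False by (simp add: n_def card_gt_0_iff)
  have S: "0 < (\<Sum>x\<in>A. a x)" using assms False by (intro sum_pos) auto
  \<comment> \<open>Jensen's inequality for the convex function \<open>t powr \<alpha>\<close> with
    uniform weights \<open>1 / n\<close>. Taking roots of order \<open>\<alpha>\<close> then leaves
    the factor \<open>n / n powr (1 / \<alpha>)\<close>, the power of the cardinality in the
    bound.\<close>
  have "(\<Sum>x\<in>A. (1 / n) *\<^sub>R a x) powr \<alpha> \<le> (\<Sum>x\<in>A. (1 / n) * a x powr \<alpha>)"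
    by (rule convex_on_sum[OF \<open>finite A\<close> False powr_convex[OF \<open>1 \<le> \<alpha>\<close>]])
       (use n pos in \<open>auto simp: n_def\<close>)
  hence "((\<Sum>x\<in>A. a x) / n) powr \<alpha> \<le> (\<Sum>x\<in>A. a x powr \<alpha>) / n"
    by (simp flip: sum_distrib_left sum_divide_distrib)
  hence "(((\<Sum>x\<in>A. a x) / n) powr \<alpha>) powr (1 / \<alpha>) \<le> ((\<Sum>x\<in>A. a x powr \<alpha>) / n) powr (1 / \<alpha>)"
    using \<open>1 \<le> \<alpha>\<close> by (intro powr_mono2) auto
  hence "(\<Sum>x\<in>A. a x) / n \<le> ((\<Sum>x\<in>A. a x powr \<alpha>) / n) powr (1 / \<alpha>)"
    using S n \<open>1 \<le> \<alpha>\<close> by (simp add: powr_powr)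
  also have "\<dots> = (\<Sum>x\<in>A. a x powr \<alpha>) powr (1 / \<alpha>) / n powr (1 / \<alpha>)"
    using n by (simp add: powr_divide sum_nonneg)
  finally have "(\<Sum>x\<in>A. a x) \<le> n * ((\<Sum>x\<in>A. a x powr \<alpha>) powr (1 / \<alpha>) / n powr (1 / \<alpha>))"
    using n by (simp add: pos_divide_le_eq mult.commute)
  thus ?thesis using n by (simp add: powr_diff flip: n_def)
qed simp

text \<open>An absolutely convergent series is a Lebesgue integral against counting measure. On a
  countable index set that measure is sigma-finite, so measurability in the parameter
  \<open>y\<close> is the measurability part of Fubini's theorem.\<close>

lemma borel_measurable_infsum:
  fixes f :: "'a \<Rightarrow> 'b \<Rightarrow> real"
  assumes "countable A" and f: "\<And>x. x \<in> A \<Longrightarrow> f x \<in> borel_measurable N"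
    and summable: "\<And>y. y \<in> space N \<Longrightarrow> (\<lambda>x. norm (f x y)) summable_on A"
  shows "(\<lambda>y. \<Sum>\<^sub>\<infinity>x\<in>A. f x y) \<in> borel_measurable N"
proof -
  interpret A: sigma_finite_measure "count_space A"
    by (rule sigma_finite_measure_count_space_countable) fact
  have "(\<lambda>(x, y). f x y) \<in> borel_measurable (count_space A \<Otimes>\<^sub>M N)"
    by (rule measurable_pair_measure_countable1) (use assms in auto)
  from measurable_pair_swap[OF this]
  have "(\<lambda>(y, x). f x y) \<in> borel_measurable (N \<Otimes>\<^sub>M count_space A)" by simp
  hence "(\<lambda>y. \<integral>x. f x y \<partial>count_space A) \<in> borel_measurable N"
    by (rule A.borel_measurable_lebesgue_integral)
  also have "?this \<longleftrightarrow> ?thesis"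
  proof (rule measurable_cong)
    fix y assume "y \<in> space N"
    from infsetsum_infsum[OF abs_summable_equivalent[THEN iffD1, OF summable[OF this]]]
    show "(\<integral>x. f x y \<partial>count_space A) = (\<Sum>\<^sub>\<infinity>x\<in>A. f x y)"
      by (simp add: infsetsum_def)
  qed
  finally show ?thesis .
qed

text \<open>Each \<open>p x\<close> is at most the total mass 1, so raising it to a power
  \<open>\<alpha> \<ge> 1\<close> cannot increase it. Comparison with \<open>p\<close> itself then
  gives both convergence and the bound.\<close>

lemma summable_on_powr_pmf:
  fixes p :: "'a \<Rightarrow> real"
  assumes "\<And>x. x \<in> A \<Longrightarrow> 0 \<le> p x" and "(p has_sum 1) A" and "1 \<le> \<alpha>"
  shows "(\<lambda>x. p x powr \<alpha>) summable_on A" and "(\<Sum>\<^sub>\<infinity>x\<in>A. p x powr \<alpha>) \<le> 1"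
proof -
  have le: "p x powr \<alpha> \<le> p x" if "x \<in> A" for x
  proof -
    have "p x \<le> 1"
      using has_sum_mono2[OF has_sum_finite[of "{x}" p] assms(2)] that assms(1) by auto
    thus ?thesis using assms(1)[OF that] powr_mono'[of 1 \<alpha> "p x"] \<open>1 \<le> \<alpha>\<close> by simp
  qed
  have p: "p summable_on A" using assms(2) by (rule has_sum_imp_summable)
  show *: "(\<lambda>x. p x powr \<alpha>) summable_on A"
    by (rule summable_on_comparison_test[OF p]) (use le in auto)
  have "(\<Sum>\<^sub>\<infinity>x\<in>A. p x powr \<alpha>) \<le> (\<Sum>\<^sub>\<infinity>x\<in>A. p x)"
    by (rule infsum_mono[OF * p]) (use le in auto)
  thus "(\<Sum>\<^sub>\<infinity>x\<in>A. p x powr \<alpha>) \<le> 1" using infsumI[OF assms(2)] by simp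
qed

text \<open>The event of correct decoding splits into countably many disjoint slices, one for each
  value \<open>x\<close> of the first coordinate. The defining property of \<open>K\<close>
  evaluates each slice, and Tonelli's theorem moves the sum over \<open>x\<close> inside the
  integral over observations.\<close>

lemma emeasure_list_event:
  assumes P: "prob_space P" "sets P = sets (count_space \<X> \<Otimes>\<^sub>M N)" "countable \<X>"
    and K: "cond_pmf_version \<X> N P K"
    and \<L>: "\<L> \<in> N \<rightarrow>\<^sub>M count_space (nsets \<X> L)"
  shows "emeasure P {z \<in> space P. fst z \<in> \<L> (snd z)} =
    (\<integral>\<^sup>+y. ennreal (\<Sum>x\<in>\<L> y. K x y) \<partial>observation_law N P)"
proof -
  interpret P: prob_space P by fact
  define Q where "Q = observation_law N P"
  have snd: "snd \<in> P \<rightarrow>\<^sub>M N" using measurable_cong_sets[OF P(2) refl] measurable_snd by blast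
  interpret Q: prob_space Q
    unfolding Q_def observation_law_def using snd by (rule P.prob_space_distr)
  have sQ [simp]: "sets Q = sets N" "space Q = space N"
    by (simp_all add: Q_def observation_law_def)
  have spP: "space P = \<X> \<times> space N"
    using sets_eq_imp_space_eq[OF P(2)] by (simp add: space_pair_measure)
  have \<L>': "\<L> y \<subseteq> \<X>" "finite (\<L> y)" if "y \<in> space N" for y
    using measurable_space[OF \<L> that] by (auto simp: nsets_def)
  define A where "A x = {y \<in> space N. x \<in> \<L> y}" for x
  have A: "A x \<in> sets N" for x
  proof -
    \<comment> \<open>The space of lists is discrete, so the collection of lists containing
      \<open>x\<close> is measurable and so is its preimage.\<close>
    have "A x = \<L> -` {B \<in> nsets \<X> L. x \<in> B} \<inter> space N"
      using measurable_space[OF \<L>] by (auto simp: A_def)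
    thus ?thesis using measurable_sets[OF \<L>, of "{B \<in> nsets \<X> L. x \<in> B}"] by auto
  qed
  have Km: "K x \<in> borel_measurable Q" if "x \<in> \<X>" for x
    using K that unfolding cond_pmf_version_def measurable_cong_sets[OF sQ(1) refl] by blast
  have K0: "0 \<le> K x y" if "x \<in> \<X>" "y \<in> space N" for x y
    using K that unfolding cond_pmf_version_def by blast
  have K1: "K x y \<le> 1" if "x \<in> \<X>" "y \<in> space N" for x y
  proof -
    have "((\<lambda>x. K x y) has_sum 1) \<X>" using K that unfolding cond_pmf_version_def by blast
    from has_sum_mono2[OF has_sum_finite[of "{x}" "\<lambda>x. K x y"] this] show ?thesis
      using that K0 by auto
  qed
  have slice: "emeasure P ({x} \<times> A x) = (\<integral>\<^sup>+y. ennreal (indicator (A x) y * K x y) \<partial>Q)"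
    if x: "x \<in> \<X>" for x
  proof -
    have m: "(\<lambda>y. indicator (A x) y * K x y) \<in> borel_measurable Q"
      using A[of x] Km[OF x] by (intro borel_measurable_times borel_measurable_indicator) auto
    \<comment> \<open>\<open>K\<close> is specified through a Bochner integral. Boundedness by 1
      makes the integrand integrable, which allows the passage to the nonnegative integral needed
      for Tonelli.\<close>
    have i: "integrable Q (\<lambda>y. indicator (A x) y * K x y)"
      by (rule Q.integrable_const_bound[where B = 1])
         (use m K0[OF x] K1[OF x] in \<open>auto intro!: AE_I2 simp: indicator_def\<close>)
    have "measure P ({x} \<times> A x) = (\<integral>y. indicator (A x) y * K x y \<partial>Q)"
      using K x A[of x] unfolding cond_pmf_version_def Q_def set_lebesgue_integral_def by simp
    also have "ennreal \<dots> = (\<integral>\<^sup>+y. ennreal (indicator (A x) y * K x y) \<partial>Q)"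
      by (rule nn_integral_eq_integral[symmetric, OF i])
         (use K0[OF x] in \<open>auto intro!: AE_I2 simp: indicator_def\<close>)
    finally show ?thesis by (simp add: P.emeasure_eq_measure)
  qed
  have "{z \<in> space P. fst z \<in> \<L> (snd z)} = (\<Union>x\<in>\<X>. {x} \<times> A x)"
    by (auto simp: spP A_def)
  also have "emeasure P \<dots> = (\<integral>\<^sup>+x. emeasure P ({x} \<times> A x) \<partial>count_space \<X>)"
    by (rule emeasure_UN_countable)
       (use P A in \<open>auto simp: disjoint_family_on_def intro!: pair_measureI\<close>)
  also have "\<dots> = (\<integral>\<^sup>+x. \<integral>\<^sup>+y. ennreal (indicator (A x) y * K x y) \<partial>Q \<partial>count_space \<X>)"
    by (rule nn_integral_cong) (simp add: slice)
  also have "\<dots> = (\<integral>\<^sup>+y. \<integral>\<^sup>+x. ennreal (indicator (A x) y * K x y) \<partial>count_space \<X> \<partial>Q)"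
    by (rule nn_integral_count_space_nn_integral[symmetric])
       (use P(3) A Km in \<open>auto intro!: measurable_compose[OF _ measurable_ennreal]
          borel_measurable_times borel_measurable_indicator\<close>)
  also have "\<dots> = (\<integral>\<^sup>+y. ennreal (\<Sum>x\<in>\<L> y. K x y) \<partial>Q)"
  proof (rule nn_integral_cong)
    fix y assume "y \<in> space Q"
    hence y: "y \<in> space N" by simp
    \<comment> \<open>For fixed \<open>y\<close> the indicator vanishes off the list
      \<open>\<L> y\<close>, so the integral over \<open>\<X>\<close> collapses to a finite
      sum.\<close>
    have "(\<integral>\<^sup>+x. ennreal (indicator (A x) y * K x y) \<partial>count_space \<X>) =
        (\<Sum>x\<in>\<L> y. ennreal (indicator (A x) y * K x y))"
      by (rule nn_integral_count_space') (use \<L>'[OF y] in \<open>auto simp: A_def\<close>)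
    also have "\<dots> = (\<Sum>x\<in>\<L> y. ennreal (K x y))"
      by (rule sum.cong) (use y in \<open>auto simp: A_def\<close>)
    also have "\<dots> = ennreal (\<Sum>x\<in>\<L> y. K x y)"
      by (rule sum_ennreal) (use \<L>'[OF y] K0[OF _ y] in auto)
    finally show "(\<integral>\<^sup>+x. ennreal (indicator (A x) y * K x y) \<partial>count_space \<X>) =
        ennreal (\<Sum>x\<in>\<L> y. K x y)" .
  qed
  finally show ?thesis by (simp add: Q_def)
qed

theorem theorem10:
  fixes b \<alpha> :: real
    and \<X> :: "'x set"
    and N :: "'y measure"
    and P :: "('x \<times> 'y) measure"
    and K :: "'x \<Rightarrow> 'y \<Rightarrow> real"
    and L :: nat
    and \<L> :: "'y \<Rightarrow> 'x set"
  assumes "1 < b"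
    and "countable \<X>"
    and "prob_space P"
    and "sets P = sets (count_space \<X> \<Otimes>\<^sub>M N)"
    and "cond_pmf_version \<X> N P K"
    and "\<And>x y. x \<in> \<X> \<Longrightarrow> y \<in> space N \<Longrightarrow> 0 < K x y"
    and "1 \<le> L"
    and "finite \<X> \<Longrightarrow> L \<le> card \<X>"
    and "\<L> \<in> N \<rightarrow>\<^sub>M count_space (nsets \<X> L)"
    and "1 < \<alpha>"
  shows "\<P>(z in P. fst z \<notin> \<L> (snd z))
    \<ge> 1 - b powr ((1 - \<alpha>) / \<alpha> * (arimoto_renyi_cond_entropy b \<alpha> \<X> N P K - log b (real L)))"
proof -
  interpret P: prob_space P by fact
  define Q where "Q = observation_law N P"
  have snd: "snd \<in> P \<rightarrow>\<^sub>M N"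
    using measurable_cong_sets[OF assms(4) refl] measurable_snd by blast
  interpret Q: prob_space Q
    unfolding Q_def observation_law_def using snd by (rule P.prob_space_distr)
  have sQ [simp]: "sets Q = sets N" "space Q = space N"
    by (simp_all add: Q_def observation_law_def)
  define S where "S y = (\<Sum>\<^sub>\<infinity>x\<in>\<X>. K x y powr \<alpha>) powr (1 / \<alpha>)" for y
  define E where "E = (\<integral>y. S y \<partial>Q)"
  define c where "c = real L powr (1 - 1 / \<alpha>)"
  have c: "0 < c" using assms(7) by (simp add: c_def)
  have \<L>: "\<L> y \<subseteq> \<X>" "finite (\<L> y)" "card (\<L> y) = L" if "y \<in> space N" for y
    using measurable_space[OF assms(9) that] by (auto simp: nsets_def)
  have Kpos: "0 < K x y" if "x \<in> \<X>" "y \<in> space N" for x y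
    using assms(6) that by blast
  have Ksum: "((\<lambda>x. K x y) has_sum 1) \<X>" if "y \<in> space N" for y
    using assms(5) that unfolding cond_pmf_version_def by blast
  have summable: "(\<lambda>x. K x y powr \<alpha>) summable_on \<X>"
    and sum_le: "(\<Sum>\<^sub>\<infinity>x\<in>\<X>. K x y powr \<alpha>) \<le> 1" if "y \<in> space N" for y
    using summable_on_powr_pmf[OF less_imp_le[OF Kpos] Ksum[OF that]] that assms(10) by auto
  have list_le: "(\<Sum>x\<in>\<L> y. K x y powr \<alpha>) \<le> (\<Sum>\<^sub>\<infinity>x\<in>\<X>. K x y powr \<alpha>)" if "y \<in> space N" for y
    by (rule finite_sum_le_infsum) (use summable \<L> that in auto)
  \<comment> \<open>Since \<open>L \<ge> 1\<close>, the list is nonempty and contributes a positive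
    finite part of the series.\<close>
  have Spos: "0 < S y" if y: "y \<in> space N" for y
  proof -
    have "\<L> y \<noteq> {}" using \<L>(3)[OF y] assms(7) by auto
    hence "0 < (\<Sum>x\<in>\<L> y. K x y powr \<alpha>)"
      using \<L>[OF y] Kpos y by (intro sum_pos) (auto, fastforce)
    with list_le[OF y] show ?thesis by (simp add: S_def)
  qed
  have S_le: "S y \<le> 1" if "y \<in> space N" for y
    using powr_mono2[of "1 / \<alpha>" _ 1, OF _ infsum_nonneg sum_le[OF that]] assms(10)
    by (simp add: S_def)
  have "(\<lambda>y. \<Sum>\<^sub>\<infinity>x\<in>\<X>. K x y powr \<alpha>) \<in> borel_measurable N"
  proof (rule borel_measurable_infsum[OF assms(2)])
    show "(\<lambda>y. K x y powr \<alpha>) \<in> borel_measurable N" if "x \<in> \<X>" for x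
      using assms(5) that unfolding cond_pmf_version_def by (intro powr_real_measurable) auto
  qed (use summable in simp)
  hence "S \<in> borel_measurable Q"
    unfolding S_def measurable_cong_sets[OF sQ(1) refl] by (intro powr_real_measurable) auto
  hence Sint: "integrable Q S"
    by (rule Q.integrable_const_bound[rotated, where B = 1])
       (use Spos S_le in \<open>auto intro!: AE_I2 simp: abs_of_pos\<close>)
  \<comment> \<open>Strictness comes from \<open>S\<close> being positive everywhere on a space of
    mass 1. It makes \<open>log b E\<close> genuine, so that \<open>b powr log b E\<close> returns
    \<open>E\<close> at the end.\<close>
  have "(\<integral>y. 0 \<partial>Q) < E"
    unfolding E_def by (rule Q.integral_less_AE_space)
      (use Sint Spos Q.emeasure_space_1 in \<open>auto intro!: AE_I2\<close>)
  hence E: "0 < E" by simp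

  have "emeasure P {z \<in> space P. fst z \<in> \<L> (snd z)} = (\<integral>\<^sup>+y. ennreal (\<Sum>x\<in>\<L> y. K x y) \<partial>Q)"
    unfolding Q_def by (rule emeasure_list_event) fact+
  also have "\<dots> \<le> (\<integral>\<^sup>+y. ennreal (c * S y) \<partial>Q)"
  proof (intro nn_integral_mono ennreal_leI)
    fix y assume "y \<in> space Q"
    hence y: "y \<in> space N" by simp
    have "(\<Sum>x\<in>\<L> y. K x y) \<le> c * (\<Sum>x\<in>\<L> y. K x y powr \<alpha>) powr (1 / \<alpha>)"
      using sum_le_card_powr_mult_powr_sum[OF \<L>(2)[OF y], of "\<lambda>x. K x y" \<alpha>] \<L>[OF y] Kpos y assms(10)
      by (auto simp: c_def)
    \<comment> \<open>Extending the sum from the list to all of \<open>\<X>\<close> removes the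
      dependence on the decoder.\<close>
    also have "\<dots> \<le> c * S y"
      unfolding S_def using list_le[OF y] assms(10) c
      by (intro mult_left_mono powr_mono2 sum_nonneg) auto
    finally show "(\<Sum>x\<in>\<L> y. K x y) \<le> c * S y" .
  qed
  also have "\<dots> = ennreal (c * E)"
    by (subst nn_integral_eq_integral)
       (use Sint c Spos in \<open>auto intro!: AE_I2 less_imp_le simp: E_def\<close>)
  finally have le: "\<P>(z in P. fst z \<in> \<L> (snd z)) \<le> c * E"
    using c E by (simp add: P.emeasure_eq_measure)

  have ev: "{z \<in> space P. fst z \<in> \<L> (snd z)} \<in> sets P"
  proof -
    \<comment> \<open>Because \<open>\<X>\<close> is countable, it suffices to fix the first
      coordinate; what remains is \<open>\<L>\<close> followed by a predicate on a discrete
      space.\<close>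
    have "(\<lambda>z. fst z \<in> \<L> (snd z)) \<in> count_space \<X> \<Otimes>\<^sub>M N \<rightarrow>\<^sub>M count_space UNIV"
    proof (rule measurable_pair_measure_countable1[OF assms(2)])
      show "(\<lambda>y. fst (x, y) \<in> \<L> (snd (x, y))) \<in> N \<rightarrow>\<^sub>M count_space UNIV" for x
        using measurable_compose[OF assms(9), of "\<lambda>B. x \<in> B"] by simp
    qed
    hence "Measurable.pred P (\<lambda>z. fst z \<in> \<L> (snd z))"
      by (simp add: measurable_cong_sets[OF assms(4) refl])
    thus ?thesis by (rule predE)
  qed
  have "\<P>(z in P. fst z \<notin> \<L> (snd z)) = 1 - \<P>(z in P. fst z \<in> \<L> (snd z))"
    using P.prob_neg[OF ev] by simp
  also have "\<dots> \<ge> 1 - c * E" using le by simp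
  also have "c * E = b powr ((1 - \<alpha>) / \<alpha> * (arimoto_renyi_cond_entropy b \<alpha> \<X> N P K - log b (real L)))"
  proof -
    \<comment> \<open>The prefactor cancels the \<open>\<alpha> / (1 - \<alpha>)\<close> of the
      entropy and leaves \<open>log b E\<close>. On \<open>- log b L\<close> it produces the
      exponent \<open>1 - 1 / \<alpha>\<close> of \<open>c\<close>.\<close>
    have "(1 - \<alpha>) / \<alpha> * (arimoto_renyi_cond_entropy b \<alpha> \<X> N P K - log b (real L)) =
        log b E + (1 - 1 / \<alpha>) * log b (real L)"
      using assms(10)
      unfolding arimoto_renyi_cond_entropy_def E_def S_def Q_def by (simp add: field_simps)
    also have "\<dots> = log b E + log b c"
      using assms(7) by (simp add: c_def log_powr)
    also have "b powr \<dots> = E * c"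
      using assms(1,7) E by (simp add: powr_add c_def)
    finally show ?thesis by simp
  qed
  finally show ?thesis .
qed

end
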